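(* Let $\mathcal A$ and $\mathcal B$ be abelian categories and $F:\mathcal B\to\mathcal A$, $G:\mathcal A\to\mathcal B$ two functors defining an equivalence of categories. Then there exists a right wide Morita context $(F,G,\eta,\rho)$ between $\mathcal A$ and $\mathcal B$.
   Context: All functors are additive. A right wide Morita context between abelian categories $\mathcal A$ and $\mathcal B$ is a datum $(F,G,\eta,\rho)$ where $F:\mathcal B\to\mathcal A$ and $G:\mathcal A\to\mathcal B$ are right exact functors and $\eta:F\circ G\to 1_{\mathcal A}$, $\rho:G\circ F\to 1_{\mathcal B}$ are natural transformations with $G\eta=\rho G$ and $F\rho=\eta F$. "$F$ and $G$ define an equivalence of categories" means that there exist natural equivalences $F\circ G\to 1_{\mathcal A}$ and $G\circ F\to 1_{\mathcal B}$. *)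

theory Defs
  imports "HOL-Algebra.Group"
begin

section \<open>Categories\<close>

record ('o, 'm) cat =
  Obj :: "'o set"
  Arr :: "'m set"
  Dom :: "'m \<Rightarrow> 'o"
  Cod :: "'m \<Rightarrow> 'o"
  Id :: "'o \<Rightarrow> 'm"
  Comp :: "'m \<Rightarrow> 'm \<Rightarrow> 'm" (infixr "\<cdot>\<index>" 75)

definition Hom :: "('o, 'm, 'x) cat_scheme \<Rightarrow> 'o \<Rightarrow> 'o \<Rightarrow> 'm set" where
  "Hom C A B = {f \<in> Arr C. Dom C f = A \<and> Cod C f = B}"

text \<open>\<open>g \<cdot>\<^bsub>C\<^esub> f\<close> means first \<open>f\<close>, then \<open>g\<close>; its value is irrelevant unless
  \<open>Cod C f = Dom C g\<close>.\<close>

locale category =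
  fixes C :: "('o, 'm, 'x) cat_scheme" (structure)
  assumes dom_obj: "f \<in> Arr C \<Longrightarrow> Dom C f \<in> Obj C"
    and cod_obj: "f \<in> Arr C \<Longrightarrow> Cod C f \<in> Obj C"
    and id_hom: "A \<in> Obj C \<Longrightarrow> Id C A \<in> Hom C A A"
    and comp_hom: "f \<in> Hom C A B \<Longrightarrow> g \<in> Hom C B D \<Longrightarrow> g \<cdot> f \<in> Hom C A D"
    and comp_id_right: "f \<in> Hom C A B \<Longrightarrow> f \<cdot> Id C A = f"
    and comp_id_left: "f \<in> Hom C A B \<Longrightarrow> Id C B \<cdot> f = f"
    and comp_assoc: "f \<in> Hom C A B \<Longrightarrow> g \<in> Hom C B D \<Longrightarrow> h \<in> Hom C D E \<Longrightarrow>
          (h \<cdot> g) \<cdot> f = h \<cdot> (g \<cdot> f)"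

definition is_iso :: "('o, 'm, 'x) cat_scheme \<Rightarrow> 'm \<Rightarrow> bool" where
  "is_iso C f \<longleftrightarrow> f \<in> Arr C \<and>
     (\<exists>g \<in> Hom C (Cod C f) (Dom C f).
        g \<cdot>\<^bsub>C\<^esub> f = Id C (Dom C f) \<and> f \<cdot>\<^bsub>C\<^esub> g = Id C (Cod C f))"

definition is_mono :: "('o, 'm, 'x) cat_scheme \<Rightarrow> 'm \<Rightarrow> bool" where
  "is_mono C f \<longleftrightarrow> f \<in> Arr C \<and>
     (\<forall>X \<in> Obj C. \<forall>g \<in> Hom C X (Dom C f). \<forall>h \<in> Hom C X (Dom C f).
        f \<cdot>\<^bsub>C\<^esub> g = f \<cdot>\<^bsub>C\<^esub> h \<longrightarrow> g = h)"

definition is_epi :: "('o, 'm, 'x) cat_scheme \<Rightarrow> 'm \<Rightarrow> bool" where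
  "is_epi C f \<longleftrightarrow> f \<in> Arr C \<and>
     (\<forall>X \<in> Obj C. \<forall>g \<in> Hom C (Cod C f) X. \<forall>h \<in> Hom C (Cod C f) X.
        g \<cdot>\<^bsub>C\<^esub> f = h \<cdot>\<^bsub>C\<^esub> f \<longrightarrow> g = h)"

definition zero_object :: "('o, 'm, 'x) cat_scheme \<Rightarrow> 'o \<Rightarrow> bool" where
  "zero_object C Z \<longleftrightarrow> Z \<in> Obj C \<and>
     (\<forall>A \<in> Obj C. (\<exists>!f. f \<in> Hom C A Z) \<and> (\<exists>!f. f \<in> Hom C Z A))"


section \<open>Abelian categories\<close>

record ('o, 'm) ab_cat = "('o, 'm) cat" +
  Plus :: "'m \<Rightarrow> 'm \<Rightarrow> 'm"
  Zero :: "'o \<Rightarrow> 'o \<Rightarrow> 'm"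

definition hom_group :: "('o, 'm, 'x) ab_cat_scheme \<Rightarrow> 'o \<Rightarrow> 'o \<Rightarrow> 'm monoid" where
  "hom_group C A B = \<lparr>carrier = Hom C A B, mult = Plus C, one = Zero C A B\<rparr>"

locale preadditive_category = category C
  for C :: "('o, 'm, 'x) ab_cat_scheme" (structure) +
  assumes hom_comm_group: "A \<in> Obj C \<Longrightarrow> B \<in> Obj C \<Longrightarrow> comm_group (hom_group C A B)"
    and comp_plus_right: "f \<in> Hom C A B \<Longrightarrow> g \<in> Hom C A B \<Longrightarrow> h \<in> Hom C B D \<Longrightarrow>
          h \<cdot> Plus C f g = Plus C (h \<cdot> f) (h \<cdot> g)"
    and comp_plus_left: "f \<in> Hom C A B \<Longrightarrow> g \<in> Hom C B D \<Longrightarrow> h \<in> Hom C B D \<Longrightarrow>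
          Plus C g h \<cdot> f = Plus C (g \<cdot> f) (h \<cdot> f)"

definition is_biproduct ::
  "('o, 'm, 'x) ab_cat_scheme \<Rightarrow> 'o \<Rightarrow> 'o \<Rightarrow> 'o \<Rightarrow> 'm \<Rightarrow> 'm \<Rightarrow> 'm \<Rightarrow> 'm \<Rightarrow> bool" where
  "is_biproduct C A B P i j p q \<longleftrightarrow>
     P \<in> Obj C \<and> i \<in> Hom C A P \<and> j \<in> Hom C B P \<and> p \<in> Hom C P A \<and> q \<in> Hom C P B \<and>
     p \<cdot>\<^bsub>C\<^esub> i = Id C A \<and> q \<cdot>\<^bsub>C\<^esub> j = Id C B \<and>
     Plus C (i \<cdot>\<^bsub>C\<^esub> p) (j \<cdot>\<^bsub>C\<^esub> q) = Id C P"

text \<open>\<open>is_kernel C f k\<close>: \<open>k\<close> is a kernel of \<open>f\<close>.  Kernels and cokernels are determined only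
  up to isomorphism, so they are treated as relations.\<close>

definition is_kernel :: "('o, 'm, 'x) ab_cat_scheme \<Rightarrow> 'm \<Rightarrow> 'm \<Rightarrow> bool" where
  "is_kernel C f k \<longleftrightarrow> f \<in> Arr C \<and> k \<in> Arr C \<and> Cod C k = Dom C f \<and>
     f \<cdot>\<^bsub>C\<^esub> k = Zero C (Dom C k) (Cod C f) \<and>
     (\<forall>X \<in> Obj C. \<forall>h \<in> Hom C X (Dom C f).
        f \<cdot>\<^bsub>C\<^esub> h = Zero C X (Cod C f) \<longrightarrow>
        (\<exists>!u. u \<in> Hom C X (Dom C k) \<and> k \<cdot>\<^bsub>C\<^esub> u = h))"

definition is_cokernel :: "('o, 'm, 'x) ab_cat_scheme \<Rightarrow> 'm \<Rightarrow> 'm \<Rightarrow> bool" where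
  "is_cokernel C f c \<longleftrightarrow> f \<in> Arr C \<and> c \<in> Arr C \<and> Dom C c = Cod C f \<and>
     c \<cdot>\<^bsub>C\<^esub> f = Zero C (Dom C f) (Cod C c) \<and>
     (\<forall>X \<in> Obj C. \<forall>h \<in> Hom C (Cod C f) X.
        h \<cdot>\<^bsub>C\<^esub> f = Zero C (Dom C f) X \<longrightarrow>
        (\<exists>!u. u \<in> Hom C (Cod C c) X \<and> u \<cdot>\<^bsub>C\<^esub> c = h))"

locale abelian_category = preadditive_category C
  for C :: "('o, 'm, 'x) ab_cat_scheme" (structure) +
  assumes ex_zero_object: "\<exists>Z. zero_object C Z"
    and ex_biproduct: "A \<in> Obj C \<Longrightarrow> B \<in> Obj C \<Longrightarrow> \<exists>P i j p q. is_biproduct C A B P i j p q"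
    and ex_kernel: "f \<in> Arr C \<Longrightarrow> \<exists>k. is_kernel C f k"
    and ex_cokernel: "f \<in> Arr C \<Longrightarrow> \<exists>c. is_cokernel C f c"
    and mono_is_kernel: "is_mono C k \<Longrightarrow> \<exists>f. is_kernel C f k"
    and epi_is_cokernel: "is_epi C c \<Longrightarrow> \<exists>f. is_cokernel C f c"

text \<open>Exactness of \<open>A \<rightarrow> B \<rightarrow> D\<close>, the arrows being \<open>f\<close> and \<open>g\<close>: the image of \<open>f\<close>, that is
  the kernel \<open>k\<close> of the cokernel \<open>c\<close> of \<open>f\<close>, is the kernel of \<open>g\<close>.\<close>

definition exact_at :: "('o, 'm, 'x) ab_cat_scheme \<Rightarrow> 'm \<Rightarrow> 'm \<Rightarrow> bool" where
  "exact_at C f g \<longleftrightarrow> f \<in> Arr C \<and> g \<in> Arr C \<and> Cod C f = Dom C g \<and>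
     (\<exists>c k. is_cokernel C f c \<and> is_kernel C c k \<and> is_kernel C g k)"

text \<open>Exactness of \<open>A \<rightarrow> B \<rightarrow> D \<rightarrow> 0\<close>.\<close>

definition right_exact_sequence :: "('o, 'm, 'x) ab_cat_scheme \<Rightarrow> 'm \<Rightarrow> 'm \<Rightarrow> bool" where
  "right_exact_sequence C f g \<longleftrightarrow> exact_at C f g \<and>
     (\<exists>Z. zero_object C Z \<and> exact_at C g (Zero C (Cod C g) Z))"


section \<open>Functors and natural transformations\<close>

record ('o1, 'm1, 'o2, 'm2) functor_data =
  on_obj :: "'o1 \<Rightarrow> 'o2"
  on_arr :: "'m1 \<Rightarrow> 'm2"

definition id_functor :: "('o, 'm, 'o, 'm) functor_data" where
  "id_functor = \<lparr>on_obj = (\<lambda>A. A), on_arr = (\<lambda>f. f)\<rparr>"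

definition comp_functor ::
  "('o2, 'm2, 'o3, 'm3) functor_data \<Rightarrow> ('o1, 'm1, 'o2, 'm2) functor_data \<Rightarrow>
   ('o1, 'm1, 'o3, 'm3) functor_data" (infixr "\<circ>\<^sub>F" 75) where
  "S \<circ>\<^sub>F T = \<lparr>on_obj = on_obj S \<circ> on_obj T, on_arr = on_arr S \<circ> on_arr T\<rparr>"

locale is_functor = dom: category C + cod: category D
  for C :: "('o1, 'm1, 'x) cat_scheme"
    and D :: "('o2, 'm2, 'y) cat_scheme"
    and F :: "('o1, 'm1, 'o2, 'm2) functor_data" +
  assumes map_obj: "A \<in> Obj C \<Longrightarrow> on_obj F A \<in> Obj D"
    and map_hom: "f \<in> Hom C A B \<Longrightarrow> on_arr F f \<in> Hom D (on_obj F A) (on_obj F B)"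
    and map_id: "A \<in> Obj C \<Longrightarrow> on_arr F (Id C A) = Id D (on_obj F A)"
    and map_comp: "f \<in> Hom C A B \<Longrightarrow> g \<in> Hom C B E \<Longrightarrow>
          on_arr F (g \<cdot>\<^bsub>C\<^esub> f) = on_arr F g \<cdot>\<^bsub>D\<^esub> on_arr F f"

locale additive_functor =
  dom: preadditive_category C + cod: preadditive_category D + is_functor C D F
  for C :: "('o1, 'm1, 'x) ab_cat_scheme"
    and D :: "('o2, 'm2, 'y) ab_cat_scheme"
    and F :: "('o1, 'm1, 'o2, 'm2) functor_data" +
  assumes map_plus: "f \<in> Hom C A B \<Longrightarrow> g \<in> Hom C A B \<Longrightarrow>
          on_arr F (Plus C f g) = Plus D (on_arr F f) (on_arr F g)"

locale right_exact_functor =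
  dom: abelian_category C + cod: abelian_category D + additive_functor C D F
  for C :: "('o1, 'm1, 'x) ab_cat_scheme"
    and D :: "('o2, 'm2, 'y) ab_cat_scheme"
    and F :: "('o1, 'm1, 'o2, 'm2) functor_data" +
  assumes preserves_right_exact:
    "right_exact_sequence C f g \<Longrightarrow> right_exact_sequence D (on_arr F f) (on_arr F g)"

locale natural_transformation = source: is_functor C D S + target: is_functor C D T
  for C :: "('o1, 'm1, 'x) cat_scheme"
    and D :: "('o2, 'm2, 'y) cat_scheme"
    and S T :: "('o1, 'm1, 'o2, 'm2) functor_data"
    and \<tau> :: "'o1 \<Rightarrow> 'm2" +
  assumes component: "A \<in> Obj C \<Longrightarrow> \<tau> A \<in> Hom D (on_obj S A) (on_obj T A)"
    and naturality: "f \<in> Hom C A B \<Longrightarrow> \<tau> B \<cdot>\<^bsub>D\<^esub> on_arr S f = on_arr T f \<cdot>\<^bsub>D\<^esub> \<tau> A"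

locale natural_equivalence = natural_transformation C D S T \<tau>
  for C :: "('o1, 'm1, 'x) cat_scheme"
    and D :: "('o2, 'm2, 'y) cat_scheme"
    and S T :: "('o1, 'm1, 'o2, 'm2) functor_data"
    and \<tau> :: "'o1 \<Rightarrow> 'm2" +
  assumes component_iso: "A \<in> Obj C \<Longrightarrow> is_iso D (\<tau> A)"

definition define_equivalence ::
  "('o1, 'm1, 'x) cat_scheme \<Rightarrow> ('o2, 'm2, 'y) cat_scheme \<Rightarrow>
   ('o2, 'm2, 'o1, 'm1) functor_data \<Rightarrow> ('o1, 'm1, 'o2, 'm2) functor_data \<Rightarrow> bool" where
  "define_equivalence \<A> \<B> F G \<longleftrightarrow>
     (\<exists>\<eta>. natural_equivalence \<A> \<A> (F \<circ>\<^sub>F G) id_functor \<eta>) \<and>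
     (\<exists>\<rho>. natural_equivalence \<B> \<B> (G \<circ>\<^sub>F F) id_functor \<rho>)"


section \<open>Right wide Morita contexts\<close>

text \<open>The last two assumptions are the equalities \<open>G\<eta> = \<rho>G\<close> and \<open>F\<rho> = \<eta>F\<close> of natural
  transformations, spelled out on components.\<close>

locale right_wide_morita_context =
  left: abelian_category \<A> + right: abelian_category \<B> +
  F: right_exact_functor \<B> \<A> F + G: right_exact_functor \<A> \<B> G +
  \<eta>: natural_transformation \<A> \<A> "F \<circ>\<^sub>F G" id_functor \<eta> +
  \<rho>: natural_transformation \<B> \<B> "G \<circ>\<^sub>F F" id_functor \<rho>
  for \<A> :: "('o1, 'm1, 'x) ab_cat_scheme"
    and \<B> :: "('o2, 'm2, 'y) ab_cat_scheme"
    and F :: "('o2, 'm2, 'o1, 'm1) functor_data"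
    and G :: "('o1, 'm1, 'o2, 'm2) functor_data"
    and \<eta> :: "'o1 \<Rightarrow> 'm1"
    and \<rho> :: "'o2 \<Rightarrow> 'm2" +
  assumes G_eta: "A \<in> Obj \<A> \<Longrightarrow> on_arr G (\<eta> A) = \<rho> (on_obj G A)"
    and F_rho: "B \<in> Obj \<B> \<Longrightarrow> on_arr F (\<rho> B) = \<eta> (on_obj F B)"

end

theory Submission
  imports Defs
begin

text \<open>An equivalence is fully faithful and essentially surjective, and an additive functor of this
  kind preserves kernels, cokernels and zero objects, hence is right exact. For the compatibility
  conditions, keep an arbitrary natural equivalence \<open>\<eta> : F G \<rightarrow> 1\<close> and let \<open>\<rho>\<^sub>B\<close> be
  the unique arrow with \<open>F \<rho>\<^sub>B = \<eta>\<^bsub>F B\<^esub>\<close>. Naturality of \<open>\<eta>\<close> at the isomorphism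
  \<open>\<eta>\<^sub>A\<close> itself gives \<open>F G \<eta>\<^sub>A = \<eta>\<^bsub>F G A\<^esub> = F \<rho>\<^bsub>G A\<^esub>\<close>, and
  \<open>G \<eta>\<^sub>A = \<rho>\<^bsub>G A\<^esub>\<close> follows because \<open>F\<close> is faithful. The context obtained this way
  consists of natural equivalences; the zero transformations would be a degenerate solution.\<close>

section \<open>Isomorphisms and cancellation in a category\<close>

context category
begin

lemma Hom_objD:
  assumes "f \<in> Hom C A B"
  shows "A \<in> Obj C" "B \<in> Obj C"
  using assms dom_obj cod_obj by (auto simp: Hom_def)

lemma Arr_in_Hom: "f \<in> Arr C \<Longrightarrow> f \<in> Hom C (Dom C f) (Cod C f)"
  by (simp add: Hom_def)

lemma isoE:
  assumes "is_iso C e" "e \<in> Hom C A B"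
  obtains e' where "e' \<in> Hom C B A" "e' \<cdot> e = Id C A" "e \<cdot> e' = Id C B"
  using assms by (auto simp: is_iso_def Hom_def)

lemma isoI:
  assumes "e \<in> Hom C A B" "e' \<in> Hom C B A" "e' \<cdot> e = Id C A" "e \<cdot> e' = Id C B"
  shows "is_iso C e"
  using assms by (auto simp: is_iso_def Hom_def)

lemma iso_cancel_left:
  assumes e: "is_iso C e" "e \<in> Hom C A B" and "f \<in> Hom C X A" "g \<in> Hom C X A"
    and eq: "e \<cdot> f = e \<cdot> g"
  shows "f = g"
proof -
  obtain e' where e': "e' \<in> Hom C B A" "e' \<cdot> e = Id C A" using isoE[OF e] .
  have "h = e' \<cdot> e \<cdot> h" if "h \<in> Hom C X A" for h
    using comp_assoc[OF that e(2) e'(1)] e'(2) comp_id_left[OF that] by simp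
  then show ?thesis using assms(3,4) eq by metis
qed

lemma iso_cancel_right:
  assumes e: "is_iso C e" "e \<in> Hom C A B" and "f \<in> Hom C B X" "g \<in> Hom C B X"
    and eq: "f \<cdot> e = g \<cdot> e"
  shows "f = g"
proof -
  obtain e' where e': "e' \<in> Hom C B A" "e \<cdot> e' = Id C B" using isoE[OF e] .
  have "h = (h \<cdot> e) \<cdot> e'" if "h \<in> Hom C B X" for h
    using comp_assoc[OF e'(1) e(2) that] e'(2) comp_id_right[OF that] by simp
  then show ?thesis using assms(3,4) eq by metis
qed

end

section \<open>Zero morphisms and additivity\<close>

context preadditive_category
begin

lemma zero_hom: "A \<in> Obj C \<Longrightarrow> B \<in> Obj C \<Longrightarrow> Zero C A B \<in> Hom C A B"
  using monoid.one_closed[OF group.is_monoid[OF comm_group.axioms(2)[OF hom_comm_group[of A B]]]]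
  by (simp add: hom_group_def)

lemma plus_zero:
  assumes "A \<in> Obj C" "B \<in> Obj C"
  shows "Plus C (Zero C A B) (Zero C A B) = Zero C A B"
  using monoid.l_one[OF group.is_monoid[OF comm_group.axioms(2)[OF hom_comm_group[of A B]]]]
    zero_hom[OF assms] assms
  by (simp add: hom_group_def)

text \<open>The neutral element is the only idempotent of a group. Claims about composites and
  functor images of zero arrows thereby reduce to bilinearity and additivity.\<close>

lemma eq_zeroI:
  assumes "f \<in> Hom C A B" "Plus C f f = f"
  shows "f = Zero C A B"
proof -
  have AB: "A \<in> Obj C" "B \<in> Obj C" using Hom_objD assms by auto
  interpret comm_group "hom_group C A B" using hom_comm_group[OF AB] .
  show ?thesis using r_cancel_one'[of f f] assms by (simp add: hom_group_def)
qed

lemma comp_zero: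
  assumes "f \<in> Hom C A B" "D \<in> Obj C"
  shows "f \<cdot> Zero C D A = Zero C D B"
proof (rule eq_zeroI)
  note zero = zero_hom[OF assms(2) Hom_objD(1)[OF assms(1)]]
  show "f \<cdot> Zero C D A \<in> Hom C D B" using comp_hom[OF zero assms(1)] .
  show "Plus C (f \<cdot> Zero C D A) (f \<cdot> Zero C D A) = f \<cdot> Zero C D A"
    using comp_plus_right[OF zero zero assms(1)] plus_zero[OF assms(2) Hom_objD(1)[OF assms(1)]]
    by simp
qed

lemma zero_comp:
  assumes "f \<in> Hom C A B" "D \<in> Obj C"
  shows "Zero C B D \<cdot> f = Zero C A D"
proof (rule eq_zeroI)
  note zero = zero_hom[OF Hom_objD(2)[OF assms(1)] assms(2)]
  show "Zero C B D \<cdot> f \<in> Hom C A D" using comp_hom[OF assms(1) zero] .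
  show "Plus C (Zero C B D \<cdot> f) (Zero C B D \<cdot> f) = Zero C B D \<cdot> f"
    using comp_plus_left[OF assms(1) zero zero] plus_zero[OF Hom_objD(2)[OF assms(1)] assms(2)]
    by simp
qed

end

lemma (in additive_functor) map_zero:
  assumes "A \<in> Obj C" "B \<in> Obj C"
  shows "on_arr F (Zero C A B) = Zero D (on_obj F A) (on_obj F B)"
proof (rule cod.eq_zeroI)
  note zero = dom.zero_hom[OF assms]
  show "on_arr F (Zero C A B) \<in> Hom D (on_obj F A) (on_obj F B)" using map_hom[OF zero] .
  show "Plus D (on_arr F (Zero C A B)) (on_arr F (Zero C A B)) = on_arr F (Zero C A B)"
    using map_plus[OF zero zero] dom.plus_zero[OF assms] by simp
qed

section \<open>Fully faithful, essentially surjective functors\<close>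

text \<open>No quasi-inverse is chosen: an object of \<open>D\<close> is replaced by an image object
  along an isomorphism, and arrows between image objects are lifted. In \<open>full\<close>,
  \<open>A\<close> and \<open>B\<close> must be assumed to be objects, since \<open>h\<close> only
  has their images as endpoints.\<close>

locale equivalence_functor = is_functor C D F
  for C :: "('o1, 'm1, 'x) cat_scheme"
    and D :: "('o2, 'm2, 'y) cat_scheme"
    and F :: "('o1, 'm1, 'o2, 'm2) functor_data" +
  assumes faithful: "f \<in> Hom C A B \<Longrightarrow> g \<in> Hom C A B \<Longrightarrow> on_arr F f = on_arr F g \<Longrightarrow> f = g"
    and full: "A \<in> Obj C \<Longrightarrow> B \<in> Obj C \<Longrightarrow> h \<in> Hom D (on_obj F A) (on_obj F B) \<Longrightarrow>
          \<exists>f \<in> Hom C A B. on_arr F f = h"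
    and ess_surj: "X \<in> Obj D \<Longrightarrow> \<exists>Y \<in> Obj C. \<exists>e \<in> Hom D (on_obj F Y) X. is_iso D e"
begin

text \<open>Fullness lifts the inverse of the image; faithfulness lifts the two inverse
  laws.\<close>

lemma reflects_iso:
  assumes "f \<in> Hom C A B" "is_iso D (on_arr F f)"
  shows "is_iso C f"
proof -
  note AB = dom.Hom_objD[OF assms(1)]
  obtain e where e: "e \<in> Hom D (on_obj F B) (on_obj F A)"
    "e \<cdot>\<^bsub>D\<^esub> on_arr F f = Id D (on_obj F A)" "on_arr F f \<cdot>\<^bsub>D\<^esub> e = Id D (on_obj F B)"
    using cod.isoE[OF assms(2) map_hom[OF assms(1)]] .
  obtain g where g: "g \<in> Hom C B A" "on_arr F g = e" using full[OF AB(2,1) e(1)] by auto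
  have "g \<cdot>\<^bsub>C\<^esub> f = Id C A"
    using faithful[OF dom.comp_hom[OF assms(1) g(1)] dom.id_hom[OF AB(1)]]
      map_comp[OF assms(1) g(1)] map_id[OF AB(1)] e(2) g(2) by simp
  moreover have "f \<cdot>\<^bsub>C\<^esub> g = Id C B"
    using faithful[OF dom.comp_hom[OF g(1) assms(1)] dom.id_hom[OF AB(2)]]
      map_comp[OF g(1) assms(1)] map_id[OF AB(2)] e(3) g(2) by simp
  ultimately show ?thesis using dom.isoI[OF assms(1) g(1)] by simp
qed

text \<open>By fullness, uniqueness of arrows to and from \<open>Z\<close> carries over to arrows
  between image objects; an arbitrary \<open>X\<close> is compared with an image object along
  \<open>e\<close>.\<close>

lemma preserves_zero_object:
  assumes "zero_object C Z"
  shows "zero_object D (on_obj F Z)"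
  unfolding zero_object_def
proof (intro conjI ballI)
  have Z: "Z \<in> Obj C" using assms by (simp add: zero_object_def)
  then show "on_obj F Z \<in> Obj D" by (rule map_obj)
  fix X assume "X \<in> Obj D"
  then obtain Y e where Y: "Y \<in> Obj C" and e: "e \<in> Hom D (on_obj F Y) X" "is_iso D e"
    using ess_surj by blast
  obtain e' where e': "e' \<in> Hom D X (on_obj F Y)" "e' \<cdot>\<^bsub>D\<^esub> e = Id D (on_obj F Y)"
     "e \<cdot>\<^bsub>D\<^esub> e' = Id D X" using cod.isoE[OF e(2,1)] .
  have e'_iso: "is_iso D e'" using cod.isoI[OF e'(1) e(1) e'(3,2)] .
  obtain t where t: "t \<in> Hom C Y Z" and t_unique: "\<And>f. f \<in> Hom C Y Z \<Longrightarrow> f = t"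
    using assms Y unfolding zero_object_def by metis
  obtain s where s: "s \<in> Hom C Z Y" and s_unique: "\<And>f. f \<in> Hom C Z Y \<Longrightarrow> f = s"
    using assms Y unfolding zero_object_def by metis
  have to_unique: "f = on_arr F t" if "f \<in> Hom D (on_obj F Y) (on_obj F Z)" for f
    using full[OF Y Z that] t_unique by auto
  have from_unique: "f = on_arr F s" if "f \<in> Hom D (on_obj F Z) (on_obj F Y)" for f
    using full[OF Z Y that] s_unique by auto
  show "\<exists>!f. f \<in> Hom D X (on_obj F Z)"
  proof (rule ex1I)
    show t': "on_arr F t \<cdot>\<^bsub>D\<^esub> e' \<in> Hom D X (on_obj F Z)"
      using cod.comp_hom[OF e'(1) map_hom[OF t]] .
    fix f assume f: "f \<in> Hom D X (on_obj F Z)"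
    \<comment> \<open>Both sides run between image objects, where only \<open>on_arr F t\<close> is
      available; \<open>e\<close> can then be cancelled.\<close>
    have "f \<cdot>\<^bsub>D\<^esub> e = (on_arr F t \<cdot>\<^bsub>D\<^esub> e') \<cdot>\<^bsub>D\<^esub> e"
      using to_unique[OF cod.comp_hom[OF e(1) f]] to_unique[OF cod.comp_hom[OF e(1) t']] by simp
    then show "f = on_arr F t \<cdot>\<^bsub>D\<^esub> e'" using cod.iso_cancel_right[OF e(2,1) f t'] by simp
  qed
  show "\<exists>!f. f \<in> Hom D (on_obj F Z) X"
  proof (rule ex1I)
    show s': "e \<cdot>\<^bsub>D\<^esub> on_arr F s \<in> Hom D (on_obj F Z) X"
      using cod.comp_hom[OF map_hom[OF s] e(1)] .
    fix f assume f: "f \<in> Hom D (on_obj F Z) X"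
    \<comment> \<open>Dually, composing with \<open>e'\<close> moves the target to an image object,
      where the arrow is forced to be \<open>on_arr F s\<close>.\<close>
    have "e' \<cdot>\<^bsub>D\<^esub> f = e' \<cdot>\<^bsub>D\<^esub> e \<cdot>\<^bsub>D\<^esub> on_arr F s"
      using from_unique[OF cod.comp_hom[OF f e'(1)]] from_unique[OF cod.comp_hom[OF s' e'(1)]]
      by simp
    then show "f = e \<cdot>\<^bsub>D\<^esub> on_arr F s"
      using cod.iso_cancel_left[OF e'_iso e'(1) f s'] by simp
  qed
qed

end

section \<open>Kernels, cokernels and exactness under additive equivalences\<close>

locale additive_equivalence = additive_functor C D F + equivalence_functor C D F
  for C :: "('o1, 'm1, 'x) ab_cat_scheme"
    and D :: "('o2, 'm2, 'y) ab_cat_scheme"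
    and F :: "('o1, 'm1, 'o2, 'm2) functor_data"
begin

text \<open>A test arrow from an arbitrary \<open>X\<close> is precomposed with \<open>e\<close> so
  that it starts at an image object. It then lifts to \<open>C\<close>, where the universal property
  of \<open>k\<close> applies, and the factorization is carried back along
  \<open>e'\<close>.\<close>

lemma preserves_kernel:
  assumes "is_kernel C f k"
  shows "is_kernel D (on_arr F f) (on_arr F k)"
proof -
  define A B K where "A = Dom C f" and "B = Cod C f" and "K = Dom C k"
  have f: "f \<in> Hom C A B" and k: "k \<in> Hom C K A" and fk: "f \<cdot>\<^bsub>C\<^esub> k = Zero C K B"
    and univ: "\<And>X h. X \<in> Obj C \<Longrightarrow> h \<in> Hom C X A \<Longrightarrow> f \<cdot>\<^bsub>C\<^esub> h = Zero C X B \<Longrightarrow>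
        \<exists>!u. u \<in> Hom C X K \<and> k \<cdot>\<^bsub>C\<^esub> u = h"
    using assms by (auto simp: is_kernel_def Hom_def A_def B_def K_def)
  note objs = dom.Hom_objD[OF f] dom.Hom_objD[OF k]
  note Ff = map_hom[OF f] and Fk = map_hom[OF k]
  have zero: "on_arr F f \<cdot>\<^bsub>D\<^esub> on_arr F k = Zero D (on_obj F K) (on_obj F B)"
    using map_comp[OF k f] fk map_zero objs by simp
  have "\<exists>!u. u \<in> Hom D X (on_obj F K) \<and> on_arr F k \<cdot>\<^bsub>D\<^esub> u = h"
    if X: "X \<in> Obj D" and h: "h \<in> Hom D X (on_obj F A)"
      and fh: "on_arr F f \<cdot>\<^bsub>D\<^esub> h = Zero D X (on_obj F B)" for X h
  proof -
    obtain Y e where Y: "Y \<in> Obj C" and e: "e \<in> Hom D (on_obj F Y) X" "is_iso D e"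
      using ess_surj[OF X] by blast
    obtain e' where e': "e' \<in> Hom D X (on_obj F Y)" "e \<cdot>\<^bsub>D\<^esub> e' = Id D X"
      using cod.isoE[OF e(2,1)] .
    have he: "h \<cdot>\<^bsub>D\<^esub> e \<in> Hom D (on_obj F Y) (on_obj F A)" using cod.comp_hom[OF e(1) h] .
    obtain h' where h': "h' \<in> Hom C Y A" "on_arr F h' = h \<cdot>\<^bsub>D\<^esub> e"
      using full[OF Y objs(1) he] by blast
    \<comment> \<open>The lift \<open>h'\<close> is a legitimate test arrow for \<open>k\<close>:
      its composite with \<open>f\<close> has zero image, hence is zero by faithfulness.\<close>
    have "on_arr F (f \<cdot>\<^bsub>C\<^esub> h') = (on_arr F f \<cdot>\<^bsub>D\<^esub> h) \<cdot>\<^bsub>D\<^esub> e"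
      using map_comp[OF h'(1) f] h'(2) cod.comp_assoc[OF e(1) h Ff] by simp
    also have "\<dots> = on_arr F (Zero C Y B)"
      using fh cod.zero_comp[OF e(1) map_obj] map_zero Y objs by simp
    finally have "f \<cdot>\<^bsub>C\<^esub> h' = Zero C Y B"
      using faithful[OF dom.comp_hom[OF h'(1) f] dom.zero_hom] Y objs by simp
    then have ex1: "\<exists>!u. u \<in> Hom C Y K \<and> k \<cdot>\<^bsub>C\<^esub> u = h'" using univ[OF Y h'(1)] by simp
    then obtain u where u: "u \<in> Hom C Y K" "k \<cdot>\<^bsub>C\<^esub> u = h'" by blast
    show ?thesis
    \<comment> \<open>\<open>u\<close> factors the lift of the composite of \<open>h\<close> with
      \<open>e\<close>, so \<open>e'\<close> is needed to undo the change of source.\<close>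
    proof (rule ex1I[of _ "on_arr F u \<cdot>\<^bsub>D\<^esub> e'"], intro conjI)
      show "on_arr F u \<cdot>\<^bsub>D\<^esub> e' \<in> Hom D X (on_obj F K)"
        using cod.comp_hom[OF e'(1) map_hom[OF u(1)]] .
      have "on_arr F k \<cdot>\<^bsub>D\<^esub> on_arr F u \<cdot>\<^bsub>D\<^esub> e' = (h \<cdot>\<^bsub>D\<^esub> e) \<cdot>\<^bsub>D\<^esub> e'"
        using cod.comp_assoc[OF e'(1) map_hom[OF u(1)] Fk] map_comp[OF u(1) k] u(2) h'(2) by simp
      also have "\<dots> = h" using cod.comp_assoc[OF e'(1) e(1) h] e'(2) cod.comp_id_right[OF h] by simp
      finally show "on_arr F k \<cdot>\<^bsub>D\<^esub> on_arr F u \<cdot>\<^bsub>D\<^esub> e' = h" .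
    next
      fix v assume v: "v \<in> Hom D X (on_obj F K) \<and> on_arr F k \<cdot>\<^bsub>D\<^esub> v = h"
      then have ve: "v \<cdot>\<^bsub>D\<^esub> e \<in> Hom D (on_obj F Y) (on_obj F K)" using cod.comp_hom[OF e(1)] by simp
      \<comment> \<open>A competing factorization \<open>v\<close> is lifted in the same way;
        \<open>w\<close> solves the factorization problem of \<open>u\<close> in \<open>C\<close>,
        so uniqueness there decides.\<close>
      obtain w where w: "w \<in> Hom C Y K" "on_arr F w = v \<cdot>\<^bsub>D\<^esub> e"
        using full[OF Y objs(3) ve] by blast
      have "on_arr F (k \<cdot>\<^bsub>C\<^esub> w) = on_arr F h'"
        using map_comp[OF w(1) k] w(2) h'(2) v cod.comp_assoc[OF e(1) _ Fk, of v] by simp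
      then have "k \<cdot>\<^bsub>C\<^esub> w = h'" using faithful[OF dom.comp_hom[OF w(1) k] h'(1)] by simp
      then have "w = u" using ex1 w(1) u by blast
      then show "v = on_arr F u \<cdot>\<^bsub>D\<^esub> e'"
        using w(2) cod.comp_assoc[OF e'(1) e(1), of v "on_obj F K"] e'(2)
          cod.comp_id_right[of v X "on_obj F K"] v by simp
    qed
  qed
  moreover have "on_arr F f \<in> Arr D" "Dom D (on_arr F f) = on_obj F A"
    "Cod D (on_arr F f) = on_obj F B" "on_arr F k \<in> Arr D"
    "Dom D (on_arr F k) = on_obj F K"
    "Cod D (on_arr F k) = on_obj F A"
    using Ff Fk by (auto simp: Hom_def)
  ultimately show ?thesis
    using zero by (simp add: is_kernel_def)
qed

text \<open>Dual to the kernel case: the target of the test arrow is now moved to an image object by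
  \<open>e'\<close>, and the factorization is brought back by \<open>e\<close>.\<close>

lemma preserves_cokernel:
  assumes "is_cokernel C f c"
  shows "is_cokernel D (on_arr F f) (on_arr F c)"
proof -
  define A B K where "A = Dom C f" and "B = Cod C f" and "K = Cod C c"
  have f: "f \<in> Hom C A B" and c: "c \<in> Hom C B K" and cf: "c \<cdot>\<^bsub>C\<^esub> f = Zero C A K"
    and univ: "\<And>X h. X \<in> Obj C \<Longrightarrow> h \<in> Hom C B X \<Longrightarrow> h \<cdot>\<^bsub>C\<^esub> f = Zero C A X \<Longrightarrow>
        \<exists>!u. u \<in> Hom C K X \<and> u \<cdot>\<^bsub>C\<^esub> c = h"
    using assms by (auto simp: is_cokernel_def Hom_def A_def B_def K_def)
  note objs = dom.Hom_objD[OF f] dom.Hom_objD[OF c]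
  note Ff = map_hom[OF f] and Fc = map_hom[OF c]
  have zero: "on_arr F c \<cdot>\<^bsub>D\<^esub> on_arr F f = Zero D (on_obj F A) (on_obj F K)"
    using map_comp[OF f c] cf map_zero objs by simp
  have "\<exists>!u. u \<in> Hom D (on_obj F K) X \<and> u \<cdot>\<^bsub>D\<^esub> on_arr F c = h"
    if X: "X \<in> Obj D" and h: "h \<in> Hom D (on_obj F B) X"
      and hf: "h \<cdot>\<^bsub>D\<^esub> on_arr F f = Zero D (on_obj F A) X" for X h
  proof -
    obtain Y e where Y: "Y \<in> Obj C" and e: "e \<in> Hom D (on_obj F Y) X" "is_iso D e"
      using ess_surj[OF X] by blast
    obtain e' where e': "e' \<in> Hom D X (on_obj F Y)" "e \<cdot>\<^bsub>D\<^esub> e' = Id D X"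
      using cod.isoE[OF e(2,1)] .
    have eh: "e' \<cdot>\<^bsub>D\<^esub> h \<in> Hom D (on_obj F B) (on_obj F Y)" using cod.comp_hom[OF h e'(1)] .
    obtain h' where h': "h' \<in> Hom C B Y" "on_arr F h' = e' \<cdot>\<^bsub>D\<^esub> h"
      using full[OF objs(2) Y eh] by blast
    have "on_arr F (h' \<cdot>\<^bsub>C\<^esub> f) = e' \<cdot>\<^bsub>D\<^esub> h \<cdot>\<^bsub>D\<^esub> on_arr F f"
      using map_comp[OF f h'(1)] h'(2) cod.comp_assoc[OF Ff h e'(1)] by simp
    also have "\<dots> = on_arr F (Zero C A Y)"
      using hf cod.comp_zero[OF e'(1) map_obj] map_zero Y objs by simp
    finally have "h' \<cdot>\<^bsub>C\<^esub> f = Zero C A Y"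
      using faithful[OF dom.comp_hom[OF f h'(1)] dom.zero_hom] Y objs by simp
    then have ex1: "\<exists>!u. u \<in> Hom C K Y \<and> u \<cdot>\<^bsub>C\<^esub> c = h'" using univ[OF Y h'(1)] by simp
    then obtain u where u: "u \<in> Hom C K Y" "u \<cdot>\<^bsub>C\<^esub> c = h'" by blast
    show ?thesis
    proof (rule ex1I[of _ "e \<cdot>\<^bsub>D\<^esub> on_arr F u"], intro conjI)
      show "e \<cdot>\<^bsub>D\<^esub> on_arr F u \<in> Hom D (on_obj F K) X"
        using cod.comp_hom[OF map_hom[OF u(1)] e(1)] .
      have "(e \<cdot>\<^bsub>D\<^esub> on_arr F u) \<cdot>\<^bsub>D\<^esub> on_arr F c = e \<cdot>\<^bsub>D\<^esub> e' \<cdot>\<^bsub>D\<^esub> h"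
        using cod.comp_assoc[OF Fc map_hom[OF u(1)] e(1)] map_comp[OF c u(1)] u(2) h'(2) by simp
      also have "\<dots> = h" using cod.comp_assoc[OF h e'(1) e(1)] e'(2) cod.comp_id_left[OF h] by simp
      finally show "(e \<cdot>\<^bsub>D\<^esub> on_arr F u) \<cdot>\<^bsub>D\<^esub> on_arr F c = h" .
    next
      fix v assume v: "v \<in> Hom D (on_obj F K) X \<and> v \<cdot>\<^bsub>D\<^esub> on_arr F c = h"
      then have ev: "e' \<cdot>\<^bsub>D\<^esub> v \<in> Hom D (on_obj F K) (on_obj F Y)"
        using cod.comp_hom[OF _ e'(1)] by simp
      \<comment> \<open>As for kernels, uniqueness is tested on the lift, where \<open>w\<close> and
        \<open>u\<close> both factor \<open>h'\<close> through \<open>c\<close>.\<close>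
      obtain w where w: "w \<in> Hom C K Y" "on_arr F w = e' \<cdot>\<^bsub>D\<^esub> v"
        using full[OF objs(4) Y ev] by blast
      have "on_arr F (w \<cdot>\<^bsub>C\<^esub> c) = on_arr F h'"
        using map_comp[OF c w(1)] w(2) h'(2) v cod.comp_assoc[OF Fc _ e'(1), of v] by simp
      then have "w \<cdot>\<^bsub>C\<^esub> c = h'" using faithful[OF dom.comp_hom[OF c w(1)] h'(1)] by simp
      then have "w = u" using ex1 w(1) u by blast
      then show "v = e \<cdot>\<^bsub>D\<^esub> on_arr F u"
        using w(2) cod.comp_assoc[OF _ e'(1) e(1), of v "on_obj F K"] e'(2)
          cod.comp_id_left[of v "on_obj F K" X] v by simp
    qed
  qed
  moreover have "on_arr F f \<in> Arr D" "Dom D (on_arr F f) = on_obj F A"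
    "Cod D (on_arr F f) = on_obj F B" "on_arr F c \<in> Arr D"
    "Dom D (on_arr F c) = on_obj F B"
    "Cod D (on_arr F c) = on_obj F K"
    using Ff Fc by (auto simp: Hom_def)
  ultimately show ?thesis
    using zero by (simp add: is_cokernel_def)
qed

text \<open>Exactness is phrased through one cokernel and two kernel relations, so the images of the
  witnesses \<open>c\<close> and \<open>k\<close> are witnesses again.\<close>

lemma preserves_exact_at:
  assumes "exact_at C f g"
  shows "exact_at D (on_arr F f) (on_arr F g)"
proof -
  obtain c k where ck: "is_cokernel C f c" "is_kernel C c k" "is_kernel C g k"
    and fg: "f \<in> Arr C" "g \<in> Arr C" "Cod C f = Dom C g"
    using assms by (auto simp: exact_at_def)
  have "on_arr F f \<in> Arr D" "on_arr F g \<in> Arr D" "Cod D (on_arr F f) = Dom D (on_arr F g)"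
    using map_hom[OF dom.Arr_in_Hom[OF fg(1)]] map_hom[OF dom.Arr_in_Hom[OF fg(2)]] fg(3)
    by (auto simp: Hom_def)
  then show ?thesis
    using preserves_cokernel[OF ck(1)] preserves_kernel[OF ck(2)] preserves_kernel[OF ck(3)]
    unfolding exact_at_def by blast
qed

lemma preserves_right_exact_sequence:
  assumes "right_exact_sequence C f g"
  shows "right_exact_sequence D (on_arr F f) (on_arr F g)"
proof -
  obtain Z where fg: "exact_at C f g" and Z: "zero_object C Z"
    and gz: "exact_at C g (Zero C (Cod C g) Z)"
    using assms by (auto simp: right_exact_sequence_def)
  have g: "g \<in> Hom C (Dom C g) (Cod C g)"
    using fg dom.Arr_in_Hom by (simp add: exact_at_def)
  \<comment> \<open>The end of the sequence is encoded by a zero arrow into some zero object; its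
    image must be exactly the designated zero arrow of \<open>D\<close>.\<close>
  have "on_arr F (Zero C (Cod C g) Z) = Zero D (Cod D (on_arr F g)) (on_obj F Z)"
    using map_zero dom.Hom_objD[OF g] Z map_hom[OF g] by (auto simp: zero_object_def Hom_def)
  then show ?thesis
    using preserves_exact_at[OF fg] preserves_exact_at[OF gz] preserves_zero_object[OF Z]
    unfolding right_exact_sequence_def by metis
qed

end

section \<open>From natural equivalences to fully faithful, essentially surjective functors\<close>

text \<open>Naturality gives \<open>f \<cdot> \<eta> A = \<eta> B \<cdot> S (T f)\<close>, so
  \<open>T f\<close> determines \<open>f\<close> once the isomorphism \<open>\<eta> A\<close> is
  cancelled.\<close>

lemma natural_equivalence_faithful:
  assumes "natural_equivalence C C (S \<circ>\<^sub>F T) id_functor \<eta>"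
    and "f \<in> Hom C A B" "g \<in> Hom C A B" "on_arr T f = on_arr T g"
  shows "f = g"
proof -
  interpret \<eta>: natural_equivalence C C "S \<circ>\<^sub>F T" id_functor \<eta> by (rule assms(1))
  have A: "A \<in> Obj C" using \<eta>.source.dom.Hom_objD(1)[OF assms(2)] .
  have \<eta>A: "\<eta> A \<in> Hom C (on_obj (S \<circ>\<^sub>F T) A) A" using \<eta>.component[OF A] by (simp add: id_functor_def)
  have "f \<cdot>\<^bsub>C\<^esub> \<eta> A = g \<cdot>\<^bsub>C\<^esub> \<eta> A"
    using \<eta>.naturality[OF assms(2)] \<eta>.naturality[OF assms(3)] assms(4)
    by (simp add: id_functor_def comp_functor_def)
  then show ?thesis
    using \<eta>.source.dom.iso_cancel_right[OF \<eta>.component_iso[OF A] \<eta>A assms(2,3)] by simp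
qed

text \<open>\<open>\<eta>\<close> makes \<open>T\<close> faithful, and the components of
  \<open>\<rho>\<close> witness essential surjectivity. Fullness uses both, since it relies on
  faithfulness of \<open>S\<close>.\<close>

lemma equivalence_functorI:
  assumes "is_functor C D T" "is_functor D C S"
    and \<eta>: "natural_equivalence C C (S \<circ>\<^sub>F T) id_functor \<eta>"
    and \<rho>: "natural_equivalence D D (T \<circ>\<^sub>F S) id_functor \<rho>"
  shows "equivalence_functor C D T"
proof -
  interpret T: is_functor C D T by fact
  interpret S: is_functor D C S by fact
  interpret \<eta>: natural_equivalence C C "S \<circ>\<^sub>F T" id_functor \<eta> by fact
  interpret \<rho>: natural_equivalence D D "T \<circ>\<^sub>F S" id_functor \<rho> by fact
  have \<eta>_hom: "\<eta> A \<in> Hom C (on_obj S (on_obj T A)) A" if "A \<in> Obj C" for A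
    using \<eta>.component[OF that] by (simp add: id_functor_def comp_functor_def)
  show ?thesis
  proof
    show "f = g" if "f \<in> Hom C A B" "g \<in> Hom C A B" "on_arr T f = on_arr T g" for f g A B
      using natural_equivalence_faithful[OF \<eta> that] .
  next
    fix X assume X: "X \<in> Obj D"
    then have "\<rho> X \<in> Hom D (on_obj T (on_obj S X)) X"
      using \<rho>.component by (simp add: id_functor_def comp_functor_def)
    then show "\<exists>Y\<in>Obj C. \<exists>e\<in>Hom D (on_obj T Y) X. is_iso D e"
      using S.map_obj[OF X] \<rho>.component_iso[OF X] by blast
  next
    fix A B h assume A: "A \<in> Obj C" and B: "B \<in> Obj C" and h: "h \<in> Hom D (on_obj T A) (on_obj T B)"
    obtain e where e: "e \<in> Hom C A (on_obj S (on_obj T A))"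
      "e \<cdot>\<^bsub>C\<^esub> \<eta> A = Id C (on_obj S (on_obj T A))"
      using T.dom.isoE[OF \<eta>.component_iso[OF A] \<eta>_hom[OF A]] .
    note Sh = S.map_hom[OF h]
    note \<eta>Sh = T.dom.comp_hom[OF Sh \<eta>_hom[OF B]]
    \<comment> \<open>With \<open>e\<close> the inverse of \<open>\<eta> A\<close>, this is the only
      candidate: if \<open>T f = h\<close>, naturality forces
      \<open>f \<cdot> \<eta> A = \<eta> B \<cdot> S h\<close>.\<close>
    define f where "f = (\<eta> B \<cdot>\<^bsub>C\<^esub> on_arr S h) \<cdot>\<^bsub>C\<^esub> e"
    have f: "f \<in> Hom C A B" unfolding f_def using T.dom.comp_hom[OF e(1) \<eta>Sh] .
    have "\<eta> B \<cdot>\<^bsub>C\<^esub> on_arr S (on_arr T f) = f \<cdot>\<^bsub>C\<^esub> \<eta> A"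
      using \<eta>.naturality[OF f] by (simp add: id_functor_def comp_functor_def)
    also have "\<dots> = \<eta> B \<cdot>\<^bsub>C\<^esub> on_arr S h"
      unfolding f_def using T.dom.comp_assoc[OF \<eta>_hom[OF A] e(1) \<eta>Sh] e(2)
        T.dom.comp_id_right[OF \<eta>Sh] by simp
    finally have "on_arr S (on_arr T f) = on_arr S h"
      using T.dom.iso_cancel_left[OF \<eta>.component_iso[OF B] \<eta>_hom[OF B]
        S.map_hom[OF T.map_hom[OF f]] Sh] by simp
    \<comment> \<open>Faithfulness of \<open>S\<close>, obtained from \<open>\<rho>\<close> with the
      roles of the two functors exchanged.\<close>
    then have "on_arr T f = h"
      using natural_equivalence_faithful[OF \<rho> T.map_hom[OF f] h] by simp
    then show "\<exists>f\<in>Hom C A B. on_arr T f = h" using f by blast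
  qed
qed

section \<open>Replacing the second natural equivalence by a compatible one\<close>

text \<open>A given pair \<open>\<eta>\<close>, \<open>\<rho>'\<close> need not be compatible.
  \<open>\<rho>'\<close> enters through the proof that \<open>F\<close> is fully faithful and is
  then replaced by a lift of \<open>\<eta>\<close>.\<close>

lemma equivalence_compatible_counit:
  assumes "is_functor \<B> \<A> F" "is_functor \<A> \<B> G"
    and \<eta>: "natural_equivalence \<A> \<A> (F \<circ>\<^sub>F G) id_functor \<eta>"
    and \<rho>': "natural_equivalence \<B> \<B> (G \<circ>\<^sub>F F) id_functor \<rho>'"
  obtains \<rho> where "natural_equivalence \<B> \<B> (G \<circ>\<^sub>F F) id_functor \<rho>"
    and "\<And>A. A \<in> Obj \<A> \<Longrightarrow> on_arr G (\<eta> A) = \<rho> (on_obj G A)"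
    and "\<And>B. B \<in> Obj \<B> \<Longrightarrow> on_arr F (\<rho> B) = \<eta> (on_obj F B)"
proof -
  interpret F: equivalence_functor \<B> \<A> F
    using equivalence_functorI[OF assms(1,2) \<rho>' \<eta>] .
  interpret G: is_functor \<A> \<B> G by fact
  interpret \<eta>: natural_equivalence \<A> \<A> "F \<circ>\<^sub>F G" id_functor \<eta> by fact
  interpret \<rho>': natural_equivalence \<B> \<B> "G \<circ>\<^sub>F F" id_functor \<rho>' by fact
  have \<eta>_hom: "\<eta> A \<in> Hom \<A> (on_obj F (on_obj G A)) A" if "A \<in> Obj \<A>" for A
    using \<eta>.component[OF that] by (simp add: id_functor_def comp_functor_def)
  have \<eta>_nat: "\<eta> B \<cdot>\<^bsub>\<A>\<^esub> on_arr F (on_arr G f) = f \<cdot>\<^bsub>\<A>\<^esub> \<eta> A" if "f \<in> Hom \<A> A B" for f A B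
    using \<eta>.naturality[OF that] by (simp add: id_functor_def comp_functor_def)
  \<comment> \<open>The component of \<open>\<eta>\<close> at \<open>F B\<close> runs from
    \<open>F (G (F B))\<close> to \<open>F B\<close>, both images under \<open>F\<close>, so
    fullness applies.\<close>
  have "\<exists>r. r \<in> Hom \<B> (on_obj G (on_obj F B)) B \<and> on_arr F r = \<eta> (on_obj F B)"
    if "B \<in> Obj \<B>" for B
    using F.full[OF G.map_obj[OF F.map_obj[OF that]] that \<eta>_hom[OF F.map_obj[OF that]]] by blast
  then obtain \<rho> where \<rho>_hom: "\<And>B. B \<in> Obj \<B> \<Longrightarrow> \<rho> B \<in> Hom \<B> (on_obj G (on_obj F B)) B"
    and F\<rho>: "\<And>B. B \<in> Obj \<B> \<Longrightarrow> on_arr F (\<rho> B) = \<eta> (on_obj F B)"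
    by metis
  show ?thesis
  proof (rule that)
    show "natural_equivalence \<B> \<B> (G \<circ>\<^sub>F F) id_functor \<rho>"
    proof
      fix B assume B: "B \<in> Obj \<B>"
      show "\<rho> B \<in> Hom \<B> (on_obj (G \<circ>\<^sub>F F) B) (on_obj id_functor B)"
        using \<rho>_hom[OF B] by (simp add: id_functor_def comp_functor_def)
      show "is_iso \<B> (\<rho> B)"
        using F.reflects_iso[OF \<rho>_hom[OF B]] F\<rho>[OF B] \<eta>.component_iso[OF F.map_obj[OF B]] by simp
    next
      fix f A B assume f: "f \<in> Hom \<B> A B"
      note AB = F.dom.Hom_objD[OF f]
      note GFf = G.map_hom[OF F.map_hom[OF f]]
      \<comment> \<open>After applying \<open>F\<close>, naturality of \<open>\<rho>\<close> at
        \<open>f\<close> becomes naturality of \<open>\<eta>\<close> at \<open>F f\<close>;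
        faithfulness then removes \<open>F\<close>.\<close>
      have "on_arr F (\<rho> B \<cdot>\<^bsub>\<B>\<^esub> on_arr G (on_arr F f)) = on_arr F (f \<cdot>\<^bsub>\<B>\<^esub> \<rho> A)"
        using F.map_comp[OF GFf \<rho>_hom[OF AB(2)]] F.map_comp[OF \<rho>_hom[OF AB(1)] f]
          F\<rho>[OF AB(1)] F\<rho>[OF AB(2)] \<eta>_nat[OF F.map_hom[OF f]] by simp
      then show "\<rho> B \<cdot>\<^bsub>\<B>\<^esub> on_arr (G \<circ>\<^sub>F F) f = on_arr id_functor f \<cdot>\<^bsub>\<B>\<^esub> \<rho> A"
        using F.faithful[OF F.dom.comp_hom[OF GFf \<rho>_hom[OF AB(2)]]
            F.dom.comp_hom[OF \<rho>_hom[OF AB(1)] f]]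
        by (simp add: id_functor_def comp_functor_def)
    qed
  next
    fix A assume A: "A \<in> Obj \<A>"
    note GA = G.map_obj[OF A]
    note G\<eta> = G.map_hom[OF \<eta>_hom[OF A]]
    have "on_arr F (on_arr G (\<eta> A)) = \<eta> (on_obj F (on_obj G A))"
      using F.cod.iso_cancel_left[OF \<eta>.component_iso[OF A] \<eta>_hom[OF A] F.map_hom[OF G\<eta>]
          \<eta>_hom[OF F.map_obj[OF GA]] \<eta>_nat[OF \<eta>_hom[OF A]]] .
    then show "on_arr G (\<eta> A) = \<rho> (on_obj G A)"
      using F.faithful[OF G\<eta> \<rho>_hom[OF GA]] F\<rho>[OF GA] by simp
  qed (rule F\<rho>)
qed

section \<open>Right exactness and assembly of the context\<close>

lemma right_exact_functorI:
  assumes "abelian_category C" "abelian_category D" "additive_functor C D F"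
    and "equivalence_functor C D F"
  shows "right_exact_functor C D F"
proof -
  interpret C: abelian_category C by fact
  interpret D: abelian_category D by fact
  interpret F: additive_functor C D F by fact
  interpret E: equivalence_functor C D F by fact
  interpret additive_equivalence C D F by unfold_locales
  show ?thesis by unfold_locales (rule preserves_right_exact_sequence)
qed

theorem proposition2p11:
  fixes \<A> :: "('o1, 'm1) ab_cat"
    and \<B> :: "('o2, 'm2) ab_cat"
    and F :: "('o2, 'm2, 'o1, 'm1) functor_data"
    and G :: "('o1, 'm1, 'o2, 'm2) functor_data"
  assumes "abelian_category \<A>"
    and "abelian_category \<B>"
    and "additive_functor \<B> \<A> F"
    and "additive_functor \<A> \<B> G"
    and "define_equivalence \<A> \<B> F G"
  shows "\<exists>\<eta> \<rho>. right_wide_morita_context \<A> \<B> F G \<eta> \<rho>"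
proof -
  obtain \<eta> \<rho>' where \<eta>: "natural_equivalence \<A> \<A> (F \<circ>\<^sub>F G) id_functor \<eta>"
    and \<rho>': "natural_equivalence \<B> \<B> (G \<circ>\<^sub>F F) id_functor \<rho>'"
    using assms(5) by (auto simp: define_equivalence_def)
  have F: "is_functor \<B> \<A> F" and G: "is_functor \<A> \<B> G"
    using assms(3,4) by (auto simp: additive_functor_def)
  obtain \<rho> where \<rho>: "natural_equivalence \<B> \<B> (G \<circ>\<^sub>F F) id_functor \<rho>"
    and compat: "\<And>A. A \<in> Obj \<A> \<Longrightarrow> on_arr G (\<eta> A) = \<rho> (on_obj G A)"
      "\<And>B. B \<in> Obj \<B> \<Longrightarrow> on_arr F (\<rho> B) = \<eta> (on_obj F B)"
    using equivalence_compatible_counit[OF F G \<eta> \<rho>'] by metis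
  \<comment> \<open>The natural equivalence on the source category comes first, so
    \<open>\<rho>\<close> and \<open>\<eta>\<close> change places between \<open>F\<close> and
    \<open>G\<close>.\<close>
  have "right_exact_functor \<B> \<A> F"
    using right_exact_functorI[OF assms(2,1,3) equivalence_functorI[OF F G \<rho> \<eta>]] .
  moreover have "right_exact_functor \<A> \<B> G"
    using right_exact_functorI[OF assms(1,2,4) equivalence_functorI[OF G F \<eta> \<rho>]] .
  ultimately have "right_wide_morita_context \<A> \<B> F G \<eta> \<rho>"
    using assms(1,2) \<eta> \<rho> compat
    by (simp add: right_wide_morita_context_def right_wide_morita_context_axioms_def
        natural_equivalence_def)
  then show ?thesis by blast
qed

end
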